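(* The Bayesian predictive density with respect to a prior $\pi(\mu)$ on $\mathbb{R}^d$ under the $L^2$ Wasserstein loss is the plug-in density with the posterior mean of $\mu$: $$\hat{p}_{\pi}(y\mid x)=f(y-\hat{\mu}^{\pi}(x)),\qquad \hat{\mu}^{\pi}(x)=\int\mu\,\pi(\mu\mid x)\,\mathrm{d}\mu=\frac{\int\mu\,p(x\mid\mu)\pi(\mu)\,\mathrm{d}\mu}{\int p(x\mid\mu)\pi(\mu)\,\mathrm{d}\mu}.$$ Its risk function is equal to the quadratic risk function of the Bayes estimator $\hat{\mu}^{\pi}(x)$: $$R(\mu,\hat{p}_{\pi})=\mathrm{E}_{\mu}\|\hat{\mu}^{\pi}(x)-\mu\|^2\quad\text{for every }\mu\in\mathbb{R}^d .$$
   Context: Let $f:\mathbb{R}^d\to[0,\infty)$ satisfy $\int f(z)\,\mathrm{d}z=1$, $\int z f(z)\,\mathrm{d}z=0$ and have finite second moments, and let $p(z\mid\mu)=f(z-\mu)$, $\mu\in\mathbb{R}^d$, be the associated location family. An observation $x\sim p(x\mid\mu)$ is used to predict an independent $y\sim p(y\mid\mu)$, with $\mu$ unknown. A predictive density is a (measurable) family $\hat{p}(\cdot\mid x)$ of probability densities on $\mathbb{R}^d$ indexed by $x\in\mathbb{R}^d$. For probability distributions $p_1,p_2$ on $\mathbb{R}^d$, $W_2(p_1,p_2)=\inf_{X,Y}\mathrm{E}[\|X-Y\|^2]^{1/2}$, the infimum being over all joint distributions of $(X,Y)$ with marginals $p_1$ and $p_2$. The $L^2$ Wasserstein loss is $W_2(p(\cdot\mid\mu),\hat{p}(\cdot\mid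 x))^2$ and the risk is $R(\mu,\hat{p})=\int W_2(p(\cdot\mid\mu),\hat{p}(\cdot\mid x))^2\,p(x\mid\mu)\,\mathrm{d}x\in[0,\infty]$. The Bayesian predictive density $\hat{p}_\pi$ with respect to a prior $\pi$ is the one minimizing the average risk: $\int R(\mu,\hat{p}_\pi)\pi(\mu)\,\mathrm{d}\mu=\min_{\hat{p}}\int R(\mu,\hat{p})\pi(\mu)\,\mathrm{d}\mu$, the minimum being over all predictive densities. $\mathrm{E}_\mu$ denotes expectation over $x\sim p(x\mid\mu)$, and $\pi(\mu\mid x)$ is the posterior density. *)

theory Defs
  imports "HOL-Probability.Probability"
begin

text \<open>Probability densities on the Euclidean space \<open>'a\<close>, with respect to Lebesgue measure.\<close>

definition prob_density :: "('a::euclidean_space \<Rightarrow> real) \<Rightarrow> bool" where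
  "prob_density p \<longleftrightarrow>
     p \<in> borel_measurable borel \<and> (\<forall>z. 0 \<le> p z) \<and> (\<integral>\<^sup>+ z. ennreal (p z) \<partial>lborel) = 1"

definition distr_of :: "('a::euclidean_space \<Rightarrow> real) \<Rightarrow> 'a measure" where
  "distr_of p = density lborel (\<lambda>z. ennreal (p z))"

definition location_density :: "('a::euclidean_space \<Rightarrow> real) \<Rightarrow> 'a \<Rightarrow> 'a \<Rightarrow> real" where
  "location_density f \<mu> z = f (z - \<mu>)"

definition couplings :: "'a::euclidean_space measure \<Rightarrow> 'a measure \<Rightarrow> ('a \<times> 'a) measure set" where
  "couplings M N =
     {P. prob_space P \<and> sets P = sets (borel \<Otimes>\<^sub>M borel) \<and>
         distr P borel fst = M \<and> distr P borel snd = N}"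

definition ennreal_sqrt :: "ennreal \<Rightarrow> ennreal" where
  "ennreal_sqrt x = (if x = \<infinity> then \<infinity> else ennreal (sqrt (enn2real x)))"

definition W2 :: "'a::euclidean_space measure \<Rightarrow> 'a measure \<Rightarrow> ennreal" where
  "W2 M N =
     (INF P\<in>couplings M N. ennreal_sqrt (\<integral>\<^sup>+ (x, y). ennreal ((norm (x - y))\<^sup>2) \<partial>P))"

text \<open>A predictive density is written \<open>q x y\<close>, for the density at \<open>y\<close> given the observation \<open>x\<close>.\<close>

definition predictive_density :: "('a::euclidean_space \<Rightarrow> 'a \<Rightarrow> real) \<Rightarrow> bool" where
  "predictive_density q \<longleftrightarrow>
     (\<lambda>(x, y). q x y) \<in> borel_measurable (borel \<Otimes>\<^sub>M borel) \<and> (\<forall>x. prob_density (q x))"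

definition wasserstein_risk ::
    "('a::euclidean_space \<Rightarrow> real) \<Rightarrow> ('a \<Rightarrow> 'a \<Rightarrow> real) \<Rightarrow> 'a \<Rightarrow> ennreal" where
  "wasserstein_risk f q \<mu> =
     (\<integral>\<^sup>+ x. (W2 (distr_of (location_density f \<mu>)) (distr_of (q x)))\<^sup>2
            * ennreal (location_density f \<mu> x) \<partial>lborel)"

definition average_risk ::
    "('a::euclidean_space \<Rightarrow> real) \<Rightarrow> ('a \<Rightarrow> real) \<Rightarrow> ('a \<Rightarrow> 'a \<Rightarrow> real) \<Rightarrow> ennreal" where
  "average_risk f \<pi> q = (\<integral>\<^sup>+ \<mu>. wasserstein_risk f q \<mu> * ennreal (\<pi> \<mu>) \<partial>lborel)"

definition bayesian_predictive_density ::
    "('a::euclidean_space \<Rightarrow> real) \<Rightarrow> ('a \<Rightarrow> real) \<Rightarrow> ('a \<Rightarrow> 'a \<Rightarrow> real) \<Rightarrow> bool" where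
  "bayesian_predictive_density f \<pi> q \<longleftrightarrow>
     predictive_density q \<and>
     (\<forall>q'. predictive_density q' \<longrightarrow> average_risk f \<pi> q \<le> average_risk f \<pi> q')"

text \<open>
  The prior is given by its density and may be improper, as long as Bayes' formula still produces
  a posterior density for almost every observation. For a proper prior this is automatic; see
  \<open>prior_if_prob_density\<close> below.
\<close>

definition prior :: "('a::euclidean_space \<Rightarrow> real) \<Rightarrow> ('a \<Rightarrow> real) \<Rightarrow> bool" where
  "prior f \<pi> \<longleftrightarrow>
     \<pi> \<in> borel_measurable borel \<and> (\<forall>\<mu>. 0 \<le> \<pi> \<mu>) \<and>
     (AE x in lborel. (\<integral>\<^sup>+ \<mu>. ennreal (location_density f \<mu> x * \<pi> \<mu>) \<partial>lborel) < \<infinity>)"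

definition marginal_density :: "('a::euclidean_space \<Rightarrow> real) \<Rightarrow> ('a \<Rightarrow> real) \<Rightarrow> 'a \<Rightarrow> real" where
  "marginal_density f \<pi> x = (\<integral> \<mu>. location_density f \<mu> x * \<pi> \<mu> \<partial>lborel)"

definition posterior_density ::
    "('a::euclidean_space \<Rightarrow> real) \<Rightarrow> ('a \<Rightarrow> real) \<Rightarrow> 'a \<Rightarrow> 'a \<Rightarrow> real" where
  "posterior_density f \<pi> x \<mu> = location_density f \<mu> x * \<pi> \<mu> / marginal_density f \<pi> x"

text \<open>
  By the conventions for division and for the Bochner integral, the value is \<open>0\<close> at observations
  \<open>x\<close> with vanishing marginal density or without a posterior mean.
\<close>

definition posterior_mean ::
    "('a::euclidean_space \<Rightarrow> real) \<Rightarrow> ('a \<Rightarrow> real) \<Rightarrow> 'a \<Rightarrow> 'a" where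
  "posterior_mean f \<pi> x = (\<integral> \<mu>. posterior_density f \<pi> x \<mu> *\<^sub>R \<mu> \<partial>lborel)"

definition quadratic_risk :: "('a::euclidean_space \<Rightarrow> real) \<Rightarrow> ('a \<Rightarrow> 'a) \<Rightarrow> 'a \<Rightarrow> ennreal" where
  "quadratic_risk f \<delta> \<mu> =
     (\<integral>\<^sup>+ x. ennreal ((norm (\<delta> x - \<mu>))\<^sup>2) \<partial>distr_of (location_density f \<mu>))"

lemma prior_if_prob_density:
  assumes f: "prob_density f" and \<pi>: "prob_density \<pi>"
  shows "prior f \<pi>"
proof -
  have [measurable]: "f \<in> borel_measurable borel" "\<pi> \<in> borel_measurable borel"
    and f0: "\<And>z. 0 \<le> f z" and \<pi>0: "\<And>z. 0 \<le> \<pi> z"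
    and f1: "(\<integral>\<^sup>+ z. ennreal (f z) \<partial>lborel) = 1" and \<pi>1: "(\<integral>\<^sup>+ z. ennreal (\<pi> z) \<partial>lborel) = 1"
    using f \<pi> by (auto simp: prob_density_def)
  have shift: "(\<integral>\<^sup>+ x. ennreal (f (x - \<mu>)) \<partial>lborel) = 1" for \<mu>
  proof -
    have "1 = (\<integral>\<^sup>+ x. ennreal (f x) \<partial>distr lborel borel ((+) (- \<mu>)))"
      using f1 by (simp add: lborel_distr_plus)
    also have "\<dots> = (\<integral>\<^sup>+ x. ennreal (f (x - \<mu>)) \<partial>lborel)"
      by (subst nn_integral_distr) simp_all
    finally show ?thesis by simp
  qed
  have "(\<integral>\<^sup>+ x. \<integral>\<^sup>+ \<mu>. ennreal (f (x - \<mu>) * \<pi> \<mu>) \<partial>lborel \<partial>lborel)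
      = (\<integral>\<^sup>+ \<mu>. \<integral>\<^sup>+ x. ennreal (f (x - \<mu>) * \<pi> \<mu>) \<partial>lborel \<partial>lborel)"
    by (rule lborel_pair.Fubini'[symmetric]) measurable
  also have "\<dots> = (\<integral>\<^sup>+ \<mu>. (\<integral>\<^sup>+ x. ennreal (f (x - \<mu>)) \<partial>lborel) * ennreal (\<pi> \<mu>) \<partial>lborel)"
    by (intro nn_integral_cong) (simp add: ennreal_mult f0 \<pi>0 nn_integral_multc)
  also have "\<dots> = 1"
    by (simp add: shift \<pi>1)
  finally have "(\<integral>\<^sup>+ x. \<integral>\<^sup>+ \<mu>. ennreal (f (x - \<mu>) * \<pi> \<mu>) \<partial>lborel \<partial>lborel) \<noteq> \<infinity>"
    by simp
  then have "AE x in lborel. (\<integral>\<^sup>+ \<mu>. ennreal (f (x - \<mu>) * \<pi> \<mu>) \<partial>lborel) \<noteq> \<infinity>"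
    by (rule nn_integral_PInf_AE[rotated]) measurable
  then show ?thesis
    by (auto simp: prior_def location_density_def \<pi>0 less_top)
qed

end

theory Submission
  imports Defs
begin

text \<open>For a coupling \<open>(X, Y)\<close> of \<open>f(\<cdot> - \<mu>)\<close> and \<open>q\<close>, the bias-variance identity
  \<open>E|X - Y|\<^sup>2 = |\<mu> - m|\<^sup>2 + E|(X - \<mu>) - (Y - m)|\<^sup>2\<close>, with \<open>m\<close> the mean of \<open>q\<close>, separates
  the squared error of \<open>m\<close> as an estimator of \<open>\<mu>\<close> from a cost of the shape of \<open>q\<close> that does not
  involve \<open>\<mu>\<close> and vanishes for translates of \<open>f\<close>. The first part is minimized in the posterior
  average by the posterior mean, the second by the plug-in shape. For uniqueness, the shape cost is
  bounded below by \<open>(E h(X - \<mu>) - E h(Y - m))\<^sup>2\<close> for \<open>h\<close> in a countable family of 1-Lipschitz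
  functions that separates probability measures.\<close>

section \<open>Second moments and the bias-variance identity\<close>

lemma norm_diff_squared_le:
  fixes x y :: "'a::real_normed_vector"
  shows "(norm (x - y))\<^sup>2 \<le> 2 * (norm x)\<^sup>2 + 2 * (norm y)\<^sup>2"
proof -
  have "(norm (x - y))\<^sup>2 \<le> (norm x + norm y)\<^sup>2"
    by (intro power_mono norm_triangle_ineq4) auto
  also have "\<dots> \<le> 2 * (norm x)\<^sup>2 + 2 * (norm y)\<^sup>2"
    using sum_squares_bound[of "norm x" "norm y"] by (simp add: power2_sum)
  finally show ?thesis .
qed

lemma (in finite_measure) square_integrable_norm_imp_integrable:
  fixes X :: "'a \<Rightarrow> 'b::euclidean_space"
  assumes [measurable]: "X \<in> borel_measurable M"
    and "integrable M (\<lambda>x. (norm (X x))\<^sup>2)"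
  shows "integrable M X"
proof (rule Bochner_Integration.integrable_bound)
  show "integrable M (\<lambda>x. 1 + (norm (X x))\<^sup>2)"
    using assms by simp
  show "AE x in M. norm (X x) \<le> norm (1 + (norm (X x))\<^sup>2)"
  proof (rule AE_I2)
    fix x
    have "norm (X x) \<le> 1 + (norm (X x))\<^sup>2"
      using sum_squares_bound[of "norm (X x)" 1, simplified] norm_ge_zero[of "X x"] by linarith
    then show "norm (X x) \<le> norm (1 + (norm (X x))\<^sup>2)"
      by simp
  qed
qed simp

lemma (in finite_measure) square_integrable_diff:
  fixes X Y :: "'a \<Rightarrow> 'b::euclidean_space"
  assumes [measurable]: "X \<in> borel_measurable M" "Y \<in> borel_measurable M"
    and "integrable M (\<lambda>x. (norm (X x))\<^sup>2)" "integrable M (\<lambda>x. (norm (Y x))\<^sup>2)"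
  shows "integrable M (\<lambda>x. (norm (X x - Y x))\<^sup>2)"
proof (rule Bochner_Integration.integrable_bound)
  show "integrable M (\<lambda>x. 2 * (norm (X x))\<^sup>2 + 2 * (norm (Y x))\<^sup>2)"
    using assms by simp
  show "AE x in M. norm ((norm (X x - Y x))\<^sup>2) \<le> norm (2 * (norm (X x))\<^sup>2 + 2 * (norm (Y x))\<^sup>2)"
    using norm_diff_squared_le by auto
qed simp

text \<open>Zero total mass makes \<open>M\<close> the null measure, whatever \<open>F\<close> is.
  This serves the degenerate case of observations whose posterior mass vanishes.\<close>

lemma nn_integral_zero_space:
  assumes "emeasure M (space M) = 0"
  shows "(\<integral>\<^sup>+x. F x \<partial>M) = 0"
proof -
  have "M = null_measure M"
    using assms by (metis emeasure_space le_zero_eq measure_eqI emeasure_null_measure sets_null_measure)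
  then show ?thesis
    using nn_integral_null_measure by metis
qed

text \<open>Expanding the square about the mean \<open>c\<close>, the cross term integrates to zero.
  Stated in \<open>ennreal\<close>, the identity also covers an \<open>X\<close> that is not square
  integrable: the integrals about \<open>b\<close> and about \<open>c\<close> are then both
  infinite. The total mass is left general because the identity is applied both to couplings and to
  the unnormalized posterior.\<close>

lemma (in finite_measure) nn_integral_norm_diff_squared:
  fixes X :: "'a \<Rightarrow> 'b::euclidean_space"
  assumes [measurable]: "X \<in> borel_measurable M"
  defines "c \<equiv> (\<integral>x. X x \<partial>M) /\<^sub>R measure M (space M)"
  shows "(\<integral>\<^sup>+x. ennreal ((norm (X x - b))\<^sup>2) \<partial>M) =
    (\<integral>\<^sup>+x. ennreal ((norm (X x - c))\<^sup>2) \<partial>M) + ennreal ((norm (c - b))\<^sup>2) * emeasure M (space M)"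
proof (cases "measure M (space M) = 0")
  case True
  then have "(\<integral>\<^sup>+x. F x \<partial>M) = 0" for F
    by (intro nn_integral_zero_space) (simp add: emeasure_eq_measure)
  with True show ?thesis
    by (simp add: emeasure_eq_measure)
next
  case m: False
  show ?thesis
  proof (cases "integrable M (\<lambda>x. (norm (X x))\<^sup>2)")
    case sq: True
    have int: "integrable M X"
      by (rule square_integrable_norm_imp_integrable) (use sq in auto)
    have sqd: "integrable M (\<lambda>x. (norm (X x - d))\<^sup>2)" for d
      by (rule square_integrable_diff) (use sq in auto)
    have eq: "(norm (X x - b))\<^sup>2 = (norm (X x - c))\<^sup>2 + 2 * ((X x - c) \<bullet> (c - b)) + (norm (c - b))\<^sup>2"
      for x
      unfolding power2_norm_eq_inner by (simp add: inner_diff_left inner_diff_right inner_commute)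
    have "(\<integral>x. (X x - c) \<bullet> (c - b) \<partial>M) = (\<integral>x. X x - c \<partial>M) \<bullet> (c - b)"
      using int by (intro integral_inner_left) auto
    also have "(\<integral>x. X x - c \<partial>M) = 0"
      using int m by (simp add: c_def)
    finally have mid: "(\<integral>x. (X x - c) \<bullet> (c - b) \<partial>M) = 0" by simp
    have "(\<integral>x. (norm (X x - b))\<^sup>2 \<partial>M)
        = (\<integral>x. (norm (X x - c))\<^sup>2 \<partial>M) + (norm (c - b))\<^sup>2 * measure M (space M)"
      unfolding eq using int sqd mid by simp
    then show ?thesis
      using sqd by (simp add: nn_integral_eq_integral emeasure_eq_measure ennreal_plus
          flip: ennreal_mult)
  next
    case False
    have inf: "(\<integral>\<^sup>+x. ennreal ((norm (X x - d))\<^sup>2) \<partial>M) = \<infinity>" for d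
    proof (rule ccontr)
      assume "\<not> ?thesis"
      then have "integrable M (\<lambda>x. (norm (X x - d))\<^sup>2)"
        by (intro integrableI_nonneg) (auto simp: less_top)
      then have "integrable M (\<lambda>x. (norm ((X x - d) - (- d)))\<^sup>2)"
        by (rule square_integrable_diff[rotated 2]) auto
      with False show False by simp
    qed
    show ?thesis by (simp add: inf)
  qed
qed

text \<open>This is the bias-variance identity about \<open>0\<close> with the variance dropped; the
  second moment may be infinite.\<close>

lemma (in prob_space) square_expectation_le:
  fixes X :: "'a \<Rightarrow> real"
  assumes "X \<in> borel_measurable M"
  shows "ennreal ((expectation X)\<^sup>2) \<le> (\<integral>\<^sup>+x. ennreal ((X x)\<^sup>2) \<partial>M)"
  using nn_integral_norm_diff_squared[OF assms, of 0]
  by (simp add: prob_space emeasure_space_1)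

section \<open>Bounds for the squared Wasserstein distance\<close>

lemma ennreal_sqrt_mono: "x \<le> y \<Longrightarrow> ennreal_sqrt x \<le> ennreal_sqrt y"
  by (auto simp: ennreal_sqrt_def top.extremum_unique less_top
      intro!: ennreal_leI real_sqrt_le_mono enn2real_mono)

lemma ennreal_sqrt_power2: "(ennreal_sqrt x)\<^sup>2 = x"
  by (auto simp: ennreal_sqrt_def ennreal_power less_top power2_eq_square[of top] ennreal_top_mult)

text \<open>The infimum in \<open>W2\<close> runs over square roots of costs, so a bound on the
  costs is passed through the monotone root and squared back. No optimal coupling is
  invoked.\<close>

lemma W2_squared_ge:
  assumes "\<And>P. P \<in> couplings M N \<Longrightarrow> l \<le> (\<integral>\<^sup>+ (x, y). ennreal ((norm (x - y))\<^sup>2) \<partial>P)"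
  shows "l \<le> (W2 M N)\<^sup>2"
proof -
  have "ennreal_sqrt l \<le> W2 M N"
    unfolding W2_def by (intro INF_greatest ennreal_sqrt_mono assms)
  then have "(ennreal_sqrt l)\<^sup>2 \<le> (W2 M N)\<^sup>2"
    by (rule power_mono) simp
  then show ?thesis by (simp add: ennreal_sqrt_power2)
qed

lemma W2_squared_le:
  assumes "P \<in> couplings M N"
  shows "(W2 M N)\<^sup>2 \<le> (\<integral>\<^sup>+ (x, y). ennreal ((norm (x - y))\<^sup>2) \<partial>P)"
proof -
  have "(W2 M N)\<^sup>2 \<le> (ennreal_sqrt (\<integral>\<^sup>+ (x, y). ennreal ((norm (x - y))\<^sup>2) \<partial>P))\<^sup>2"
    unfolding W2_def by (intro power_mono INF_lower assms) simp
  then show ?thesis by (simp add: ennreal_sqrt_power2)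
qed

lemma lipschitz_imp_borel_measurable:
  fixes h :: "'a::euclidean_space \<Rightarrow> real"
  shows "L-lipschitz_on UNIV h \<Longrightarrow> h \<in> borel_measurable borel"
  by (intro borel_measurable_continuous_onI lipschitz_on_continuous_on)

text \<open>Translating both marginals of a coupling to mean zero splits off the squared distance of the
  means; the transport cost of the centred coupling is at least that of any Lipschitz statistic.\<close>

lemma W2_squared_lower_bound:
  fixes M N :: "'a::euclidean_space measure"
  assumes [measurable_cong]: "sets M = sets borel" "sets N = sets borel"
    and sqM: "integrable M (\<lambda>x. (norm x)\<^sup>2)"
    and lip: "1-lipschitz_on UNIV h"
  defines "a \<equiv> \<integral>x. x \<partial>M" and "b \<equiv> \<integral>y. y \<partial>N"
  shows "(if (\<integral>\<^sup>+y. ennreal ((norm y)\<^sup>2) \<partial>N) = \<infinity> then \<infinity>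
      else ennreal ((norm (a - b))\<^sup>2 + ((\<integral>x. h (x - a) \<partial>M) - (\<integral>y. h (y - b) \<partial>N))\<^sup>2))
    \<le> (W2 M N)\<^sup>2"
proof (rule W2_squared_ge)
  fix P :: "('a \<times> 'a) measure"
  assume "P \<in> couplings M N"
  then have "prob_space P" and setsP[measurable_cong]: "sets P = sets (borel \<Otimes>\<^sub>M borel)"
    and M: "M = distr P borel fst" and N: "N = distr P borel snd"
    by (auto simp: couplings_def)
  interpret prob_space P by fact
  have hlip: "\<bar>h x - h y\<bar> \<le> norm (x - y)" for x y
    using lipschitz_onD[OF lip, of x y] by (simp add: dist_norm)
  have hm[measurable]: "h \<in> borel_measurable borel"
    using lip by (rule lipschitz_imp_borel_measurable)
  let ?C = "\<integral>\<^sup>+ (x, y). ennreal ((norm (x - y))\<^sup>2) \<partial>P"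
  have sqX: "integrable P (\<lambda>z. (norm (fst z))\<^sup>2)"
    using sqM unfolding M by (subst (asm) integrable_distr_eq) auto
  show "(if (\<integral>\<^sup>+y. ennreal ((norm y)\<^sup>2) \<partial>N) = \<infinity> then \<infinity>
      else ennreal ((norm (a - b))\<^sup>2 + ((\<integral>x. h (x - a) \<partial>M) - (\<integral>y. h (y - b) \<partial>N))\<^sup>2)) \<le> ?C"
  proof (cases "?C = \<infinity>")
    case False
    then have sqZ: "integrable P (\<lambda>z. (norm (fst z - snd z))\<^sup>2)"
      by (intro integrableI_nonneg) (auto simp: less_top split_beta')
    \<comment> \<open>Writing the second component as the first minus the difference, a finite cost
      forces a finite second moment of \<open>N\<close>. Hence the infinite branch of the bound
      occurs only together with an infinite cost.\<close>
    then have "integrable P (\<lambda>z. (norm (fst z - (fst z - snd z)))\<^sup>2)"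
      by (rule square_integrable_diff[rotated 2, OF sqX]) auto
    then have sqY: "integrable P (\<lambda>z. (norm (snd z))\<^sup>2)"
      by simp
    have fin: "(\<integral>\<^sup>+y. ennreal ((norm y)\<^sup>2) \<partial>N) \<noteq> \<infinity>"
      unfolding N using sqY by (subst nn_integral_distr) (auto simp: nn_integral_eq_integral)
    have X: "integrable P fst" and Y: "integrable P snd"
      using sqX sqY by (auto intro!: square_integrable_norm_imp_integrable)
    have a: "a = (\<integral>z. fst z \<partial>P)" and b: "b = (\<integral>z. snd z \<partial>P)"
      unfolding a_def b_def M N by (subst integral_distr; simp)+
    have mean: "(\<integral>z. fst z - snd z \<partial>P) = a - b"
      using X Y by (simp add: a b)
    have hX: "integrable P (\<lambda>z. h (fst z - a))" and hY: "integrable P (\<lambda>z. h (snd z - b))"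
    proof -
      \<comment> \<open>A Lipschitz \<open>h\<close> grows at most linearly, so it preserves
        integrability.\<close>
      have *: "integrable P (\<lambda>z. h (V z - d))"
        if V: "integrable P V" for V d
      proof (rule Bochner_Integration.integrable_bound)
        show "integrable P (\<lambda>z. \<bar>h 0\<bar> + norm (V z - d))"
          using V by simp
        show "AE z in P. norm (h (V z - d)) \<le> norm (\<bar>h 0\<bar> + norm (V z - d))"
        proof (rule AE_I2)
          fix z show "norm (h (V z - d)) \<le> norm (\<bar>h 0\<bar> + norm (V z - d))"
            using hlip[of "V z - d" 0] by simp
        qed
        show "(\<lambda>z. h (V z - d)) \<in> borel_measurable P"
          using borel_measurable_integrable[OF V] by measurable
      qed
      show "integrable P (\<lambda>z. h (fst z - a))" "integrable P (\<lambda>z. h (snd z - b))"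
        by (auto intro!: * X Y)
    qed
    \<comment> \<open>The mean of \<open>W\<close> is the difference of the two
      \<open>h\<close>-statistics. Jensen's inequality bounds its square by the second moment of
      \<open>W\<close>, and the Lipschitz property bounds \<open>W\<close> pointwise by the centred
      difference of the components.\<close>
    define W where "W z = h (fst z - a) - h (snd z - b)" for z
    have W[measurable]: "W \<in> borel_measurable P"
      unfolding W_def by measurable
    have hdiff: "(\<integral>x. h (x - a) \<partial>M) - (\<integral>y. h (y - b) \<partial>N) = (\<integral>z. W z \<partial>P)"
      unfolding W_def M N using hX hY by (simp add: integral_distr)
    have "ennreal ((\<integral>z. W z \<partial>P)\<^sup>2) \<le> (\<integral>\<^sup>+z. ennreal ((W z)\<^sup>2) \<partial>P)"
      by (rule square_expectation_le) simp
    also have "\<dots> \<le> (\<integral>\<^sup>+z. ennreal ((norm (fst z - snd z - (a - b)))\<^sup>2) \<partial>P)"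
    proof (intro nn_integral_mono ennreal_leI)
      fix z
      have "\<bar>W z\<bar> \<le> norm (fst z - snd z - (a - b))"
        using hlip[of "fst z - a" "snd z - b"] by (simp add: W_def algebra_simps)
      then show "(W z)\<^sup>2 \<le> (norm (fst z - snd z - (a - b)))\<^sup>2"
        by (metis abs_ge_zero power2_abs power_mono)
    qed
    finally have "ennreal ((norm (a - b))\<^sup>2 + (\<integral>z. W z \<partial>P)\<^sup>2)
        \<le> ennreal ((norm (a - b))\<^sup>2) + (\<integral>\<^sup>+z. ennreal ((norm (fst z - snd z - (a - b)))\<^sup>2) \<partial>P)"
      by (simp add: ennreal_plus)
    \<comment> \<open>Bias-variance identity about \<open>0\<close> for
      \<open>fst z - snd z\<close>, whose mean is \<open>a - b\<close>.\<close>
    also have "\<dots> = ?C"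
      using nn_integral_norm_diff_squared[of "\<lambda>z. fst z - snd z" 0]
      by (simp add: mean prob_space emeasure_space_1 split_beta' add.commute)
    finally show ?thesis
      using fin by (simp add: hdiff)
  qed simp
qed

section \<open>A countable separating family of Lipschitz functions\<close>

lemma tendsto_min_infdist_indicator:
  fixes U :: "'a::metric_space set"
  assumes "open U" "U \<noteq> UNIV"
  shows "(\<lambda>n. real (Suc n) * min (1 / real (Suc n)) (infdist z (- U))) \<longlonglongrightarrow> indicator U z"
proof (cases "z \<in> U")
  case True
  \<comment> \<open>The complement of \<open>U\<close> is closed and nonempty, so the distance to it
    is positive on \<open>U\<close>. For \<open>U = UNIV\<close> the convention that
    \<open>infdist\<close> to the empty set is \<open>0\<close> would make the limit fail.\<close>
  then have pos: "0 < infdist z (- U)"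
    using assms in_closed_iff_infdist_zero[of "- U" z] infdist_nonneg[of z "- U"]
    by (auto simp: closed_Compl less_le)
  have "eventually (\<lambda>n. 1 / real (Suc n) < infdist z (- U)) sequentially"
    using LIMSEQ_inverse_real_of_nat pos by (auto simp: order_tendsto_iff inverse_eq_divide)
  then have "eventually (\<lambda>n. real (Suc n) * min (1 / real (Suc n)) (infdist z (- U)) = 1) sequentially"
    by eventually_elim (auto simp: min_def)
  then show ?thesis
    using True by (simp add: tendsto_eventually)
qed simp

text \<open>Integrals of truncated distance functions determine the measures of the sets in a
  countable intersection-stable base, and these determine the measure on all Borel sets.
  Countability allows almost-everywhere statements, one for each function, to be combined.\<close>

lemma countable_lipschitz_separating:
  "\<exists>H :: ('a::euclidean_space \<Rightarrow> real) set. countable H \<and> (\<forall>h\<in>H. 1-lipschitz_on UNIV h) \<and>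
    (\<forall>M N. prob_space M \<longrightarrow> prob_space N \<longrightarrow> sets M = sets borel \<longrightarrow> sets N = sets borel \<longrightarrow>
      (\<forall>h\<in>H. (\<integral>x. h x \<partial>M) = (\<integral>x. h x \<partial>N)) \<longrightarrow> M = N)"
proof -
  obtain B :: "'a set set" where B: "countable B" "topological_basis B"
    using ex_countable_basis by blast
  \<comment> \<open>Closing the base under finite intersections makes it a countable pi-system; the
    empty intersection contributes \<open>UNIV\<close>.\<close>
  define E where "E = Inter ` {F. finite F \<and> F \<subseteq> B}"
  have "countable E"
    unfolding E_def using B by (intro countable_image countable_Collect_finite_subset)
  have openE: "open U" if "U \<in> E" for U
    using that B topological_basis_open by (fastforce simp: E_def intro!: open_Inter)
  have "B \<subseteq> E"
    by (auto simp: E_def intro!: image_eqI[of _ _ "{_}"])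
  with B(2) openE have "topological_basis E"
    unfolding topological_basis_def by (meson subset_trans)
  with \<open>countable E\<close> have "borel = sigma UNIV E"
    by (rule borel_eq_countable_basis)
  then have "sets borel = sets (sigma UNIV E)"
    by (rule arg_cong)
  also have "\<dots> = sigma_sets UNIV E"
    by (rule sets_measure_of) simp
  finally have sets: "sets borel = sigma_sets UNIV E" .
  have UNIV: "UNIV \<in> E"
    by (auto simp: E_def intro!: image_eqI[of _ _ "{}"])
  have stable: "Int_stable E"
  proof (rule Int_stableI)
    fix U V assume "U \<in> E" "V \<in> E"
    then obtain F G where "finite F" "F \<subseteq> B" "U = \<Inter> F" "finite G" "G \<subseteq> B" "V = \<Inter> G"
      by (auto simp: E_def)
    then show "U \<inter> V \<in> E"
      by (auto simp: E_def intro!: image_eqI[of _ _ "F \<union> G"])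
  qed
  \<comment> \<open>Truncating at \<open>1 / Suc n\<close> without rescaling keeps each function
    1-Lipschitz. The factor \<open>Suc n\<close> that turns it into an approximate indicator is
    applied outside the integral.\<close>
  define \<phi> :: "nat \<times> 'a set \<Rightarrow> 'a \<Rightarrow> real"
    where "\<phi> = (\<lambda>(n, U) z. min (1 / real (Suc n)) (infdist z (- U)))"
  define H where "H = \<phi> ` (UNIV \<times> E)"
  have cnt: "countable H"
    unfolding H_def using \<open>countable E\<close> by auto
  have lip: "1-lipschitz_on UNIV h" if h: "h \<in> H" for h
  proof (rule lipschitz_onI)
    fix x y :: 'a
    obtain n U where "h = \<phi> (n, U)"
      using h by (auto simp: H_def)
    then show "dist (h x) (h y) \<le> 1 * dist x y"
      using infdist_triangle_abs[of x "- U" y] by (auto simp: \<phi>_def dist_real_def min_def)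
  qed simp
  have eqI: "M = N"
    if "prob_space M" "prob_space N"
      and M[measurable_cong]: "sets M = sets borel" and N[measurable_cong]: "sets N = sets borel"
      and eq: "\<And>h. h \<in> H \<Longrightarrow> (\<integral>x. h x \<partial>M) = (\<integral>x. h x \<partial>N)" for M N
  proof -
    interpret M: prob_space M by fact
    interpret N: prob_space N by fact
    have lim: "(\<lambda>n. real (Suc n) * (\<integral>x. \<phi> (n, U) x \<partial>K)) \<longlonglongrightarrow> measure K U"
      if "prob_space K" and K[measurable_cong]: "sets K = sets borel" and U: "U \<in> E" "U \<noteq> UNIV" for K U
    proof -
      interpret K: prob_space K by fact
      have "(\<lambda>n. \<integral>x. real (Suc n) * \<phi> (n, U) x \<partial>K) \<longlonglongrightarrow> (\<integral>x. indicator U x \<partial>K)"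
      proof (rule integral_dominated_convergence[where w = "\<lambda>_. 1"])
        show "AE x in K. (\<lambda>n. real (Suc n) * \<phi> (n, U) x) \<longlonglongrightarrow> indicator U x"
          unfolding \<phi>_def case_prod_conv using tendsto_min_infdist_indicator openE U by (intro AE_I2) blast
        show "AE x in K. norm (real (Suc n) * \<phi> (n, U) x) \<le> 1" for n
          by (auto simp: \<phi>_def min_def field_simps infdist_nonneg)
        show "indicator U \<in> borel_measurable K"
          by (rule borel_measurable_indicator) (use openE[OF U(1)] in \<open>simp add: K\<close>)
        show "(\<lambda>x. real (Suc n) * \<phi> (n, U) x) \<in> borel_measurable K" for n
        proof -
          have [measurable]: "\<phi> (n, U) \<in> borel_measurable borel"
            by (rule lipschitz_imp_borel_measurable, rule lip) (auto simp: H_def U)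
          show ?thesis by measurable
        qed
      qed simp
      then show ?thesis
        using openE[OF U(1)] K by (simp add: sets_eq_imp_space_eq[OF K])
    qed
    show ?thesis
    proof (rule measure_eqI_generator_eq[OF stable, of UNIV _ _ "\<lambda>_. UNIV"])
      fix U assume U: "U \<in> E"
      have "measure M U = measure N U" if "U \<noteq> UNIV"
      proof (rule LIMSEQ_unique)
        show "(\<lambda>n. real (Suc n) * (\<integral>x. \<phi> (n, U) x \<partial>M)) \<longlonglongrightarrow> measure M U"
          by (rule lim) (fact+)
        have "(\<integral>x. \<phi> (n, U) x \<partial>M) = (\<integral>x. \<phi> (n, U) x \<partial>N)" for n
          by (rule eq) (auto simp: H_def U)
        moreover have "(\<lambda>n. real (Suc n) * (\<integral>x. \<phi> (n, U) x \<partial>N)) \<longlonglongrightarrow> measure N U"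
          by (rule lim) (fact+)
        ultimately show "(\<lambda>n. real (Suc n) * (\<integral>x. \<phi> (n, U) x \<partial>M)) \<longlonglongrightarrow> measure N U"
          by simp
      qed
      \<comment> \<open>The set \<open>UNIV\<close>, which the limit argument leaves out, has mass 1
        under both measures.\<close>
      then show "emeasure M U = emeasure N U"
        using M.emeasure_space_1 N.emeasure_space_1 sets_eq_imp_space_eq[OF M] sets_eq_imp_space_eq[OF N]
        by (cases "U = UNIV") (auto simp: M.emeasure_eq_measure N.emeasure_eq_measure)
    qed (use UNIV M N sets in auto)
  qed
  show ?thesis
    by (intro exI[of _ H] conjI ballI allI impI, rule cnt, erule lip, rule eqI) auto
qed

section \<open>Location families\<close>

lemma measurable_location_density [measurable (raw)]:
  assumes [measurable]: "f \<in> borel_measurable borel" "g \<in> borel_measurable M" "h \<in> borel_measurable M"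
  shows "(\<lambda>w. location_density f (g w) (h w)) \<in> borel_measurable M"
  unfolding location_density_def by measurable

lemma sets_distr_of [simp, measurable_cong]: "sets (distr_of p) = sets borel"
  by (simp add: distr_of_def)

lemma prob_space_distr_of: "prob_density p \<Longrightarrow> prob_space (distr_of p)"
  by (intro prob_spaceI) (simp add: distr_of_def prob_density_def emeasure_density)

lemma integral_distr_of:
  fixes g :: "'a::euclidean_space \<Rightarrow> 'b::{banach, second_countable_topology}"
  assumes "prob_density p" "g \<in> borel_measurable borel"
  shows "(\<integral>x. g x \<partial>distr_of p) = (\<integral>x. p x *\<^sub>R g x \<partial>lborel)"
  using assms by (auto simp: distr_of_def prob_density_def intro!: integral_density)

text \<open>By translation invariance of Lebesgue measure, the location family consists of the
  push-forwards of \<open>distr_of f\<close> under translations. Integrals over any member thus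
  reduce to integrals over \<open>distr_of f\<close>.\<close>

lemma distr_of_location_density:
  assumes "f \<in> borel_measurable borel"
  shows "distr_of (location_density f \<mu>) = distr (distr_of f) borel ((+) \<mu>)"
proof -
  have "distr_of (location_density f \<mu>) = density (distr lborel borel ((+) \<mu>)) (\<lambda>z. ennreal (f (z - \<mu>)))"
    by (simp add: distr_of_def location_density_def lborel_distr_plus)
  also have "\<dots> = distr (distr_of f) borel ((+) \<mu>)"
    using assms by (subst density_distr) (auto simp: distr_of_def)
  finally show ?thesis .
qed

locale location_model =
  fixes f :: "'a::euclidean_space \<Rightarrow> real"
  assumes density: "prob_density f"
    and second_moment: "integrable lborel (\<lambda>z. (norm z)\<^sup>2 * f z)"
    and mean_zero: "(\<integral>z. f z *\<^sub>R z \<partial>lborel) = 0"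
begin

lemma f_measurable [measurable]: "f \<in> borel_measurable borel"
  and f_nonneg: "0 \<le> f z"
  using density by (auto simp: prob_density_def)

lemma prob_space_f: "prob_space (distr_of f)"
  using density by (rule prob_space_distr_of)

lemma prob_space_location: "prob_space (distr_of (location_density f \<mu>))"
  unfolding distr_of_location_density[OF f_measurable]
  by (intro prob_space.prob_space_distr prob_space_f) simp

lemma prob_density_location: "prob_density (location_density f \<mu>)"
proof -
  interpret prob_space "distr_of (location_density f \<mu>)" by (rule prob_space_location)
  show ?thesis
    using emeasure_space_1
    by (auto simp: prob_density_def distr_of_def location_density_def f_nonneg emeasure_density)
qed

lemma square_integrable_f: "integrable (distr_of f) (\<lambda>z. (norm z)\<^sup>2)"
  using second_moment f_nonneg
  by (auto simp: distr_of_def mult.commute intro!: integrable_real_density[THEN iffD2])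

lemma integrable_f: "integrable (distr_of f) (\<lambda>z. z)"
proof -
  interpret prob_space "distr_of f" by (rule prob_space_f)
  show ?thesis
    by (rule square_integrable_norm_imp_integrable) (use square_integrable_f in auto)
qed

lemma mean_location: "(\<integral>z. z \<partial>distr_of (location_density f \<mu>)) = \<mu>"
proof -
  interpret prob_space "distr_of f" by (rule prob_space_f)
  have "(\<integral>z. z \<partial>distr_of (location_density f \<mu>)) = (\<integral>z. \<mu> + z \<partial>distr_of f)"
    unfolding distr_of_location_density[OF f_measurable] by (rule integral_distr) measurable
  also have "\<dots> = \<mu> + (\<integral>z. z \<partial>distr_of f)"
    using integrable_f by (subst Bochner_Integration.integral_add) (auto simp: prob_space)
  also have "(\<integral>z. z \<partial>distr_of f) = 0"
    using mean_zero by (simp add: integral_distr_of[OF density])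
  finally show ?thesis by simp
qed

lemma square_integrable_location:
  "integrable (distr_of (location_density f \<mu>)) (\<lambda>z. (norm z)\<^sup>2)"
proof -
  interpret prob_space "distr_of f" by (rule prob_space_f)
  have "integrable (distr_of f) (\<lambda>z. (norm (z - (- \<mu>)))\<^sup>2)"
    by (rule square_integrable_diff) (use square_integrable_f in auto)
  then show ?thesis
    unfolding distr_of_location_density[OF f_measurable]
    by (subst integrable_distr_eq) (auto simp: add.commute)
qed

text \<open>Adding the same noise \<open>z\<close> to both \<open>\<mu>\<close> and
  \<open>\<nu>\<close> gives a coupling of constant cost, hence the upper bound. The lower bound is
  the general one with \<open>h = 0\<close>, where only the distance of the means remains.\<close>

lemma W2_squared_location:
  "(W2 (distr_of (location_density f \<mu>)) (distr_of (location_density f \<nu>)))\<^sup>2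
    = ennreal ((norm (\<mu> - \<nu>))\<^sup>2)"
proof (rule antisym)
  interpret prob_space "distr_of f" by (rule prob_space_f)
  define P where "P = distr (distr_of f) (borel \<Otimes>\<^sub>M borel) (\<lambda>z. (\<mu> + z, \<nu> + z))"
  have "P \<in> couplings (distr_of (location_density f \<mu>)) (distr_of (location_density f \<nu>))"
    unfolding couplings_def P_def distr_of_location_density[OF f_measurable]
    by (auto simp: distr_distr comp_def intro!: prob_space_distr)
  then have "(W2 (distr_of (location_density f \<mu>)) (distr_of (location_density f \<nu>)))\<^sup>2
      \<le> (\<integral>\<^sup>+ (x, y). ennreal ((norm (x - y))\<^sup>2) \<partial>P)"
    by (rule W2_squared_le)
  also have "\<dots> = ennreal ((norm (\<mu> - \<nu>))\<^sup>2)"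
    unfolding P_def by (subst nn_integral_distr) (auto simp: emeasure_space_1)
  finally show "(W2 (distr_of (location_density f \<mu>)) (distr_of (location_density f \<nu>)))\<^sup>2
      \<le> ennreal ((norm (\<mu> - \<nu>))\<^sup>2)" .
  have "(\<integral>\<^sup>+y. ennreal ((norm y)\<^sup>2) \<partial>distr_of (location_density f \<nu>)) \<noteq> \<infinity>"
    using square_integrable_location by (simp add: nn_integral_eq_integral)
  then show "ennreal ((norm (\<mu> - \<nu>))\<^sup>2)
      \<le> (W2 (distr_of (location_density f \<mu>)) (distr_of (location_density f \<nu>)))\<^sup>2"
    using W2_squared_lower_bound[of "distr_of (location_density f \<mu>)" "distr_of (location_density f \<nu>)" "\<lambda>_. 0"]
    by (simp add: square_integrable_location mean_location lipschitz_on_def)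
qed

end

section \<open>A measurable lower bound for the Wasserstein loss\<close>

definition predictive_mean :: "('a::euclidean_space \<Rightarrow> 'a \<Rightarrow> real) \<Rightarrow> 'a \<Rightarrow> 'a" where
  "predictive_mean q x = (\<integral>y. q x y *\<^sub>R y \<partial>lborel)"

text \<open>A lower bound, measurable in \<open>x\<close>, for the squared Wasserstein distance of \<open>f\<close> and the
  centred \<open>q x\<close>, whose own measurability is not clear.\<close>

definition shape_discrepancy ::
    "('a::euclidean_space \<Rightarrow> real) \<Rightarrow> ('a \<Rightarrow> real) \<Rightarrow> ('a \<Rightarrow> 'a \<Rightarrow> real) \<Rightarrow> 'a \<Rightarrow> real" where
  "shape_discrepancy h f q x =
    ((\<integral>z. f z * h z \<partial>lborel) - (\<integral>y. q x y * h (y - predictive_mean q x) \<partial>lborel))\<^sup>2"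

text \<open>With the true parameter as \<open>\<delta>\<close> this bounds the loss from below; with
  the posterior mean it measures how much \<open>q x\<close> loses against the plug-in density. A
  predictive density of infinite second moment is infinitely far from every location density, hence
  the first branch. In the other branch \<open>predictive_mean\<close> is a true mean when
  \<open>q x\<close> is a probability density, not the default \<open>0\<close> of a divergent
  integral.\<close>

definition excess_loss ::
    "('a::euclidean_space \<Rightarrow> real) \<Rightarrow> ('a \<Rightarrow> real) \<Rightarrow> ('a \<Rightarrow> 'a \<Rightarrow> real) \<Rightarrow> 'a \<Rightarrow> 'a \<Rightarrow> ennreal" where
  "excess_loss h f q \<delta> x =
    (if (\<integral>\<^sup>+y. ennreal (q x y) * ennreal ((norm y)\<^sup>2) \<partial>lborel) = \<infinity> then \<infinity>
     else ennreal ((norm (\<delta> - predictive_mean q x))\<^sup>2 + shape_discrepancy h f q x))"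

lemma measurable_predictive_mean:
  assumes "predictive_density q"
  shows "predictive_mean q \<in> borel_measurable borel"
proof -
  have [measurable]: "(\<lambda>(x, y). q x y) \<in> borel_measurable (borel \<Otimes>\<^sub>M borel)"
    using assms by (simp add: predictive_density_def)
  show ?thesis
    unfolding predictive_mean_def[abs_def] by measurable
qed

lemma measurable_excess_loss:
  assumes q: "predictive_density q"
    and [measurable]: "h \<in> borel_measurable borel"
  shows "(\<lambda>(\<delta>, x). excess_loss h f q \<delta> x) \<in> borel_measurable (borel \<Otimes>\<^sub>M borel)"
proof -
  have [measurable]: "(\<lambda>(x, y). q x y) \<in> borel_measurable (borel \<Otimes>\<^sub>M borel)"
    using assms by (simp add: predictive_density_def)
  note [measurable] = measurable_predictive_mean[OF q]
  have [measurable]: "(\<lambda>x. (\<integral>\<^sup>+y. ennreal (q x y) * ennreal ((norm y)\<^sup>2) \<partial>lborel)) \<in> borel_measurable borel"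
    by measurable
  have [measurable]: "shape_discrepancy h f q \<in> borel_measurable borel"
    unfolding shape_discrepancy_def[abs_def] by measurable
  show ?thesis
    unfolding excess_loss_def by measurable
qed

text \<open>The general lower bound rewritten in terms of densities. Centring the location density
  at its mean \<open>\<mu>\<close> returns \<open>f\<close>, so the shape term does not depend on
  \<open>\<mu>\<close>.\<close>

lemma (in location_model) excess_loss_le_W2_squared:
  assumes q: "predictive_density q" and lip: "1-lipschitz_on UNIV h"
  shows "excess_loss h f q \<mu> x \<le> (W2 (distr_of (location_density f \<mu>)) (distr_of (q x)))\<^sup>2"
proof -
  have qx: "prob_density (q x)"
    using q by (simp add: predictive_density_def)
  have [measurable]: "h \<in> borel_measurable borel"
    using lip by (rule lipschitz_imp_borel_measurable)
  have [measurable]: "q x \<in> borel_measurable borel"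
    using qx by (simp add: prob_density_def)
  have mean: "(\<integral>y. y \<partial>distr_of (q x)) = predictive_mean q x"
    by (simp add: integral_distr_of[OF qx] predictive_mean_def)
  have "(\<integral>y. h (y - \<mu>) \<partial>distr_of (location_density f \<mu>)) = (\<integral>z. h z \<partial>distr_of f)"
    unfolding distr_of_location_density[OF f_measurable] by (subst integral_distr) auto
  then have shape: "shape_discrepancy h f q x = ((\<integral>y. h (y - \<mu>) \<partial>distr_of (location_density f \<mu>))
      - (\<integral>y. h (y - predictive_mean q x) \<partial>distr_of (q x)))\<^sup>2"
    by (simp add: shape_discrepancy_def integral_distr_of density qx)
  have moment: "(\<integral>\<^sup>+y. ennreal ((norm y)\<^sup>2) \<partial>distr_of (q x))
      = (\<integral>\<^sup>+y. ennreal (q x y) * ennreal ((norm y)\<^sup>2) \<partial>lborel)"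
    unfolding distr_of_def by (subst nn_integral_density) auto
  show ?thesis
    unfolding excess_loss_def shape
    using W2_squared_lower_bound[OF sets_distr_of sets_distr_of[of "q x"]
        square_integrable_location[of \<mu>] lip, unfolded mean mean_location moment] .
qed

section \<open>Posterior averages and optimality of the plug-in density\<close>

locale location_prior = location_model f for f :: "'a::euclidean_space \<Rightarrow> real" +
  fixes \<pi> :: "'a \<Rightarrow> real"
  assumes prior: "prior f \<pi>"
begin

text \<open>Left unnormalized, so that it comes directly out of exchanging the integrals and
  involves no division where the marginal density vanishes.\<close>

definition posterior_measure :: "'a \<Rightarrow> 'a measure" where
  "posterior_measure x = density lborel (\<lambda>\<mu>. ennreal (location_density f \<mu> x * \<pi> \<mu>))"

definition plug_in :: "'a \<Rightarrow> 'a \<Rightarrow> real" where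
  "plug_in x y = f (y - posterior_mean f \<pi> x)"

lemma \<pi>_measurable [measurable]: "\<pi> \<in> borel_measurable borel"
  and \<pi>_nonneg: "0 \<le> \<pi> z"
  using prior by (auto simp: prior_def)

lemma sets_posterior_measure [simp, measurable_cong]: "sets (posterior_measure x) = sets borel"
  and space_posterior_measure [simp]: "space (posterior_measure x) = UNIV"
  by (simp_all add: posterior_measure_def)

lemma weight_nonneg: "0 \<le> location_density f \<mu> x * \<pi> \<mu>"
  by (simp add: location_density_def f_nonneg \<pi>_nonneg)

lemma AE_finite_posterior_measure: "AE x in lborel. finite_measure (posterior_measure x)"
proof -
  have "AE x in lborel. (\<integral>\<^sup>+ \<mu>. ennreal (location_density f \<mu> x * \<pi> \<mu>) \<partial>lborel) < \<infinity>"
    using prior by (simp add: prior_def)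
  then show ?thesis
    by eventually_elim (auto intro!: finite_measureI simp: posterior_measure_def emeasure_density)
qed

text \<open>Infinite mass is included: the Bochner integral and \<open>measure\<close> then both
  take the value \<open>0\<close>.\<close>

lemma marginal_density_eq: "marginal_density f \<pi> x = measure (posterior_measure x) UNIV"
  unfolding marginal_density_def posterior_measure_def measure_def
  by (subst emeasure_density) (auto simp: weight_nonneg integral_eq_nn_integral)

lemma posterior_mean_eq_quotient:
  "posterior_mean f \<pi> x = (\<integral>\<mu>. (location_density f \<mu> x * \<pi> \<mu>) *\<^sub>R \<mu> \<partial>lborel) /\<^sub>R marginal_density f \<pi> x"
  unfolding posterior_mean_def posterior_density_def
  by (simp add: divide_inverse_commute flip: scaleR_scaleR)

text \<open>In this form the posterior mean is the centre \<open>c\<close> of the bias-variance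
  identity for the unnormalized posterior.\<close>

lemma posterior_mean_eq:
  "posterior_mean f \<pi> x = (\<integral>\<mu>. \<mu> \<partial>posterior_measure x) /\<^sub>R measure (posterior_measure x) UNIV"
  unfolding posterior_mean_eq_quotient marginal_density_eq
  unfolding posterior_measure_def by (subst integral_density) (auto simp: weight_nonneg)

lemma measurable_posterior_mean [measurable]: "posterior_mean f \<pi> \<in> borel_measurable borel"
  unfolding posterior_mean_def[abs_def] posterior_density_def marginal_density_def by measurable

lemma predictive_density_plug_in: "predictive_density plug_in"
proof -
  have "(\<lambda>(x, y). plug_in x y) \<in> borel_measurable (borel \<Otimes>\<^sub>M borel)"
    unfolding plug_in_def by measurable
  moreover have "plug_in x = location_density f (posterior_mean f \<pi> x)" for x
    by (simp add: plug_in_def location_density_def fun_eq_iff)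
  ultimately show ?thesis
    by (simp add: predictive_density_def prob_density_location)
qed

lemma W2_squared_plug_in:
  "(W2 (distr_of (location_density f \<mu>)) (distr_of (plug_in x)))\<^sup>2
    = ennreal ((norm (\<mu> - posterior_mean f \<pi> x))\<^sup>2)"
proof -
  have "plug_in x = location_density f (posterior_mean f \<pi> x)"
    by (simp add: plug_in_def location_density_def fun_eq_iff)
  then show ?thesis
    by (simp add: W2_squared_location)
qed

text \<open>The loss of a translate of \<open>f\<close> is the squared distance of the locations, so
  the integrands of the two risks already agree for each observation.\<close>

lemma wasserstein_risk_plug_in:
  "wasserstein_risk f plug_in \<mu> = quadratic_risk f (posterior_mean f \<pi>) \<mu>"
  unfolding wasserstein_risk_def quadratic_risk_def W2_squared_plug_in
  unfolding distr_of_def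
  by (subst nn_integral_density) (auto simp: mult.commute norm_minus_commute)

text \<open>Tonelli's theorem turns a prior average of risks into an integral over observations of
  posterior losses, which can be compared for each \<open>x\<close> separately.\<close>

lemma nn_integral_posterior_measure:
  assumes [measurable]: "(\<lambda>(\<mu>, x). G \<mu> x) \<in> borel_measurable (borel \<Otimes>\<^sub>M borel)"
  shows "(\<integral>\<^sup>+\<mu>. (\<integral>\<^sup>+x. G \<mu> x * ennreal (location_density f \<mu> x) \<partial>lborel) * ennreal (\<pi> \<mu>) \<partial>lborel)
    = (\<integral>\<^sup>+x. \<integral>\<^sup>+\<mu>. G \<mu> x \<partial>posterior_measure x \<partial>lborel)"
proof -
  have "(\<integral>\<^sup>+\<mu>. (\<integral>\<^sup>+x. G \<mu> x * ennreal (location_density f \<mu> x) \<partial>lborel) * ennreal (\<pi> \<mu>) \<partial>lborel)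
    = (\<integral>\<^sup>+\<mu>. \<integral>\<^sup>+x. G \<mu> x * ennreal (location_density f \<mu> x) * ennreal (\<pi> \<mu>) \<partial>lborel \<partial>lborel)"
    by (intro nn_integral_cong nn_integral_multc[symmetric]) measurable
  also have "\<dots> = (\<integral>\<^sup>+x. \<integral>\<^sup>+\<mu>. G \<mu> x * ennreal (location_density f \<mu> x) * ennreal (\<pi> \<mu>) \<partial>lborel \<partial>lborel)"
    by (rule lborel_pair.Fubini'[symmetric]) measurable
  also have "\<dots> = (\<integral>\<^sup>+x. \<integral>\<^sup>+\<mu>. ennreal (location_density f \<mu> x * \<pi> \<mu>) * G \<mu> x \<partial>lborel \<partial>lborel)"
    using f_nonneg \<pi>_nonneg by (simp add: ennreal_mult location_density_def mult_ac)
  also have "\<dots> = (\<integral>\<^sup>+x. \<integral>\<^sup>+\<mu>. G \<mu> x \<partial>posterior_measure x \<partial>lborel)"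
    unfolding posterior_measure_def
    by (intro nn_integral_cong nn_integral_density[symmetric]) measurable
  finally show ?thesis .
qed

lemma average_risk_plug_in:
  "average_risk f \<pi> plug_in
    = (\<integral>\<^sup>+x. \<integral>\<^sup>+\<mu>. ennreal ((norm (\<mu> - posterior_mean f \<pi> x))\<^sup>2) \<partial>posterior_measure x \<partial>lborel)"
  unfolding average_risk_def wasserstein_risk_def W2_squared_plug_in
  by (rule nn_integral_posterior_measure) measurable

text \<open>The bias-variance identity under the posterior splits off the distance from the
  posterior mean to the predictive mean, while the shape term is constant in \<open>\<mu>\<close>.
  With zero mass everything vanishes; with positive mass and an infinite second moment of
  \<open>q x\<close> the right side is infinite.\<close>

lemma nn_integral_excess_loss_posterior:
  assumes "finite_measure (posterior_measure x)"
  shows "(\<integral>\<^sup>+\<mu>. ennreal ((norm (\<mu> - posterior_mean f \<pi> x))\<^sup>2) \<partial>posterior_measure x)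
      + excess_loss h f q (posterior_mean f \<pi> x) x * emeasure (posterior_measure x) UNIV
    \<le> (\<integral>\<^sup>+\<mu>. excess_loss h f q \<mu> x \<partial>posterior_measure x)"
proof (cases "emeasure (posterior_measure x) UNIV = 0")
  case True
  then show ?thesis
    by (simp add: nn_integral_zero_space)
next
  case pos: False
  interpret finite_measure "posterior_measure x" by fact
  have D: "0 \<le> shape_discrepancy h f q x"
    by (simp add: shape_discrepancy_def)
  show ?thesis
  proof (cases "(\<integral>\<^sup>+y. ennreal (q x y) * ennreal ((norm y)\<^sup>2) \<partial>lborel) = \<infinity>")
    case True
    with pos show ?thesis
      by (simp add: excess_loss_def ennreal_top_mult)
  next
    case False
    have "(\<integral>\<^sup>+\<mu>. excess_loss h f q \<mu> x \<partial>posterior_measure x)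
      = (\<integral>\<^sup>+\<mu>. ennreal ((norm (\<mu> - predictive_mean q x))\<^sup>2) + ennreal (shape_discrepancy h f q x)
          \<partial>posterior_measure x)"
      using False D by (simp add: excess_loss_def ennreal_plus)
    also have "\<dots> = (\<integral>\<^sup>+\<mu>. ennreal ((norm (\<mu> - predictive_mean q x))\<^sup>2) \<partial>posterior_measure x)
        + ennreal (shape_discrepancy h f q x) * emeasure (posterior_measure x) UNIV"
      by (subst nn_integral_add) auto
    also have "(\<integral>\<^sup>+\<mu>. ennreal ((norm (\<mu> - predictive_mean q x))\<^sup>2) \<partial>posterior_measure x)
        = (\<integral>\<^sup>+\<mu>. ennreal ((norm (\<mu> - posterior_mean f \<pi> x))\<^sup>2) \<partial>posterior_measure x)
          + ennreal ((norm (posterior_mean f \<pi> x - predictive_mean q x))\<^sup>2)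
            * emeasure (posterior_measure x) UNIV"
      using nn_integral_norm_diff_squared[of "\<lambda>\<mu>. \<mu>" "predictive_mean q x"]
      by (simp add: posterior_mean_eq)
    finally show ?thesis
      using False D by (simp add: excess_loss_def ennreal_plus distrib_right add.assoc)
  qed
qed

text \<open>The loss of \<open>q\<close> need not be measurable in \<open>x\<close> and \<open>\<mu>\<close>, so the order of integration is
  exchanged only for the measurable lower bound \<open>excess_loss\<close>.\<close>

lemma average_risk_plug_in_add_excess_le:
  assumes q: "predictive_density q" and lip: "1-lipschitz_on UNIV h"
  shows "average_risk f \<pi> plug_in
      + (\<integral>\<^sup>+x. excess_loss h f q (posterior_mean f \<pi> x) x * emeasure (posterior_measure x) UNIV \<partial>lborel)
    \<le> average_risk f \<pi> q"
proof -
  note [measurable] = measurable_excess_loss[OF q lipschitz_imp_borel_measurable[OF lip], of f]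
  have [measurable]: "(\<lambda>x. emeasure (posterior_measure x) UNIV) \<in> borel_measurable borel"
    unfolding posterior_measure_def by (simp add: emeasure_density)
  have [measurable]: "(\<lambda>x. \<integral>\<^sup>+\<mu>. ennreal ((norm (\<mu> - posterior_mean f \<pi> x))\<^sup>2) \<partial>posterior_measure x)
      \<in> borel_measurable borel"
    unfolding posterior_measure_def by (simp add: nn_integral_density)
  have "average_risk f \<pi> plug_in
      + (\<integral>\<^sup>+x. excess_loss h f q (posterior_mean f \<pi> x) x * emeasure (posterior_measure x) UNIV \<partial>lborel)
    = (\<integral>\<^sup>+x. (\<integral>\<^sup>+\<mu>. ennreal ((norm (\<mu> - posterior_mean f \<pi> x))\<^sup>2) \<partial>posterior_measure x)
        + excess_loss h f q (posterior_mean f \<pi> x) x * emeasure (posterior_measure x) UNIV \<partial>lborel)"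
    unfolding average_risk_plug_in by (intro nn_integral_add[symmetric]) measurable
  \<comment> \<open>An improper prior may give infinite posterior mass on a null set of
    observations, so the comparison holds almost everywhere.\<close>
  also have "\<dots> \<le> (\<integral>\<^sup>+x. \<integral>\<^sup>+\<mu>. excess_loss h f q \<mu> x \<partial>posterior_measure x \<partial>lborel)"
    using AE_finite_posterior_measure
    by (intro nn_integral_mono_AE) (auto elim!: eventually_mono intro: nn_integral_excess_loss_posterior)
  also have "\<dots> = (\<integral>\<^sup>+\<mu>. (\<integral>\<^sup>+x. excess_loss h f q \<mu> x * ennreal (location_density f \<mu> x) \<partial>lborel)
      * ennreal (\<pi> \<mu>) \<partial>lborel)"
    by (rule nn_integral_posterior_measure[symmetric]) measurable
  also have "\<dots> \<le> average_risk f \<pi> q"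
    unfolding average_risk_def wasserstein_risk_def
    by (intro nn_integral_mono mult_right_mono excess_loss_le_W2_squared q lip) auto
  finally show ?thesis .
qed

lemma bayesian_predictive_density_plug_in: "bayesian_predictive_density f \<pi> plug_in"
proof -
  have "average_risk f \<pi> plug_in \<le> average_risk f \<pi> q" if "predictive_density q" for q
  proof -
    \<comment> \<open>For optimality the excess term is merely dropped as nonnegative, so the
      simplest \<open>h\<close> suffices.\<close>
    have "1-lipschitz_on UNIV (\<lambda>_::'a. 0::real)"
      by (simp add: lipschitz_on_def)
    from average_risk_plug_in_add_excess_le[OF that this] show ?thesis
      by (meson add_increasing2 order_trans le_iff_add)
  qed
  then show ?thesis
    by (simp add: bayesian_predictive_density_def predictive_density_plug_in)
qed

section \<open>Uniqueness of the Bayesian predictive density\<close>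

lemma AE_excess_loss_eq_0:
  assumes q: "bayesian_predictive_density f \<pi> q" "average_risk f \<pi> q < \<infinity>"
    and lip: "1-lipschitz_on UNIV h"
  shows "AE x in lborel. 0 < marginal_density f \<pi> x \<longrightarrow> excess_loss h f q (posterior_mean f \<pi> x) x = 0"
proof -
  let ?e = "\<lambda>x. excess_loss h f q (posterior_mean f \<pi> x) x * emeasure (posterior_measure x) UNIV"
  have pq: "predictive_density q" and le: "average_risk f \<pi> q \<le> average_risk f \<pi> plug_in"
    using q predictive_density_plug_in by (auto simp: bayesian_predictive_density_def)
  note [measurable] = measurable_excess_loss[OF pq lipschitz_imp_borel_measurable[OF lip], of f]
  have [measurable]: "(\<lambda>x. emeasure (posterior_measure x) UNIV) \<in> borel_measurable borel"
    unfolding posterior_measure_def by (simp add: emeasure_density)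
  have sum: "average_risk f \<pi> plug_in + (\<integral>\<^sup>+x. ?e x \<partial>lborel) \<le> average_risk f \<pi> q"
    using pq lip by (rule average_risk_plug_in_add_excess_le)
  have fin: "average_risk f \<pi> plug_in < \<infinity>"
    using bayesian_predictive_density_plug_in pq q(2)
    by (auto simp: bayesian_predictive_density_def intro: le_less_trans)
  \<comment> \<open>Since \<open>q\<close> is a minimizer as well, its average risk leaves no room
    for a positive excess; finiteness permits the cancellation.\<close>
  have "average_risk f \<pi> plug_in + (\<integral>\<^sup>+x. ?e x \<partial>lborel) \<le> average_risk f \<pi> plug_in + 0"
    using order_trans[OF sum le] by simp
  then have "(\<integral>\<^sup>+x. ?e x \<partial>lborel) \<le> 0"
    using fin by (subst (asm) ennreal_add_left_cancel_le) auto
  then have "(\<integral>\<^sup>+x. ?e x \<partial>lborel) = 0"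
    by simp
  then have "AE x in lborel. ?e x = 0"
    by (subst (asm) nn_integral_0_iff_AE) auto
  then show ?thesis
    by eventually_elim (auto simp: marginal_density_eq measure_def)
qed

text \<open>Vanishing excess forces the mean of \<open>q x\<close> to be the posterior mean and the
  centred \<open>q x\<close> to agree with \<open>f\<close> on every function of a separating
  family.\<close>

lemma bayesian_predictive_density_unique:
  assumes q: "bayesian_predictive_density f \<pi> q" "average_risk f \<pi> q < \<infinity>"
  shows "AE x in lborel. 0 < marginal_density f \<pi> x \<longrightarrow> (AE y in lborel. q x y = plug_in x y)"
proof -
  obtain H :: "('a \<Rightarrow> real) set" where H: "countable H" "\<And>h. h \<in> H \<Longrightarrow> 1-lipschitz_on UNIV h"
    and sep: "\<And>M N. prob_space M \<Longrightarrow> prob_space N \<Longrightarrow> sets M = sets borel \<Longrightarrow> sets N = sets borel \<Longrightarrow>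
      (\<And>h. h \<in> H \<Longrightarrow> (\<integral>x. h x \<partial>M) = (\<integral>x. h x \<partial>N)) \<Longrightarrow> M = N"
    using countable_lipschitz_separating by metis
  \<comment> \<open>The zero function fixes the mean on its own, whatever \<open>H\<close>
    contains.\<close>
  have "AE x in lborel. 0 < marginal_density f \<pi> x \<longrightarrow> excess_loss (\<lambda>_. 0) f q (posterior_mean f \<pi> x) x = 0"
    by (intro AE_excess_loss_eq_0 q) (simp add: lipschitz_on_def)
  \<comment> \<open>Countability of \<open>H\<close> merges the exceptional null sets of its members
    into one.\<close>
  moreover have "AE x in lborel. \<forall>h\<in>H. 0 < marginal_density f \<pi> x \<longrightarrow>
      excess_loss h f q (posterior_mean f \<pi> x) x = 0"
    using H by (subst AE_ball_countable) (auto intro!: AE_excess_loss_eq_0 q)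
  ultimately show ?thesis
  proof (eventually_elim, intro impI)
    fix x
    let ?\<delta> = "posterior_mean f \<pi> x"
    assume "0 < marginal_density f \<pi> x \<longrightarrow> excess_loss (\<lambda>_. 0) f q ?\<delta> x = 0"
      and "\<forall>h\<in>H. 0 < marginal_density f \<pi> x \<longrightarrow> excess_loss h f q ?\<delta> x = 0"
      and "0 < marginal_density f \<pi> x"
    then have e0: "excess_loss (\<lambda>_. 0) f q ?\<delta> x = 0"
      and eH: "\<And>h. h \<in> H \<Longrightarrow> excess_loss h f q ?\<delta> x = 0"
      by auto
    have qx: "prob_density (q x)"
      using q(1) by (simp add: bayesian_predictive_density_def predictive_density_def)
    then have [measurable]: "q x \<in> borel_measurable borel"
      by (simp add: prob_density_def)
    interpret Q: prob_space "distr_of (q x)" by (rule prob_space_distr_of[OF qx])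
    have mean: "predictive_mean q x = ?\<delta>"
      using e0 by (auto simp: excess_loss_def shape_discrepancy_def split: if_splits)
    have "distr_of f = distr (distr_of (q x)) borel (\<lambda>y. y - ?\<delta>)"
    proof (rule sep)
      show "prob_space (distr (distr_of (q x)) borel (\<lambda>y. y - ?\<delta>))"
        by (rule Q.prob_space_distr) simp
      fix h assume h: "h \<in> H"
      have [measurable]: "h \<in> borel_measurable borel"
        using H(2)[OF h] by (rule lipschitz_imp_borel_measurable)
      have "(norm (?\<delta> - predictive_mean q x))\<^sup>2 + shape_discrepancy h f q x \<le> 0"
        using eH[OF h] by (auto simp: excess_loss_def ennreal_eq_0_iff split: if_splits)
      then have "shape_discrepancy h f q x \<le> 0"
        by (simp add: mean)
      then have "(\<integral>z. f z * h z \<partial>lborel) = (\<integral>y. q x y * h (y - ?\<delta>) \<partial>lborel)"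
        by (simp add: shape_discrepancy_def mean)
      then show "(\<integral>z. h z \<partial>distr_of f) = (\<integral>z. h z \<partial>distr (distr_of (q x)) borel (\<lambda>y. y - ?\<delta>))"
        by (simp add: integral_distr integral_distr_of density qx)
    qed (simp_all add: prob_space_f)
    \<comment> \<open>Translating back by the posterior mean; equal distributions then have
      densities that agree almost everywhere.\<close>
    then have "distr_of (location_density f ?\<delta>) = distr_of (q x)"
      by (simp add: distr_of_location_density distr_distr comp_def distr_id2)
    then have "AE y in lborel. ennreal (location_density f ?\<delta> y) = ennreal (q x y)"
      unfolding distr_of_def by (subst (asm) sigma_finite_measure.density_unique_iff[OF sigma_finite_lborel]) auto
    then show "AE y in lborel. q x y = plug_in x y"
      using qx by (auto simp: location_density_def plug_in_def f_nonneg prob_density_def)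
  qed
qed

end

text \<open>Uniqueness is restricted to finite average risk because otherwise every predictive
  density is a minimizer, and to positive marginal density because the remaining observations carry
  no weight in the average risk.\<close>

theorem theorem3p2:
  fixes f \<pi> :: "'a::euclidean_space \<Rightarrow> real"
  assumes f_density: "prob_density f"
    and f_second_moment: "integrable lborel (\<lambda>z. (norm z)\<^sup>2 * f z)"
    and f_mean_zero: "(\<integral> z. f z *\<^sub>R z \<partial>lborel) = 0"
    and prior: "prior f \<pi>"
  defines "p\<pi> \<equiv> \<lambda>x y. f (y - posterior_mean f \<pi> x)"
  shows "(\<forall>x. posterior_mean f \<pi> x =
            (\<integral> \<mu>. (location_density f \<mu> x * \<pi> \<mu>) *\<^sub>R \<mu> \<partial>lborel) /\<^sub>R
            (\<integral> \<mu>. location_density f \<mu> x * \<pi> \<mu> \<partial>lborel)) \<and>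
         bayesian_predictive_density f \<pi> p\<pi> \<and>
         (\<forall>q. bayesian_predictive_density f \<pi> q \<and> average_risk f \<pi> q < \<infinity> \<longrightarrow>
            (AE x in lborel. 0 < marginal_density f \<pi> x \<longrightarrow> (AE y in lborel. q x y = p\<pi> x y))) \<and>
         (\<forall>\<mu>. wasserstein_risk f p\<pi> \<mu> = quadratic_risk f (posterior_mean f \<pi>) \<mu>)"
proof -
  interpret location_prior f \<pi>
    by unfold_locales (fact f_density f_second_moment f_mean_zero prior)+
  have "p\<pi> = plug_in"
    by (simp add: p\<pi>_def plug_in_def fun_eq_iff)
  then show ?thesis
    using posterior_mean_eq_quotient[unfolded marginal_density_def]
      bayesian_predictive_density_plug_in bayesian_predictive_density_unique wasserstein_risk_plug_in
    by simp
qed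

end
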